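(* Let $G$ be a tight CR stratified group with $\dim(\mathfrak{g}_{-1})=2m$. Then exactly one of the following holds: (i) $\mathfrak{g}_{-1}=\mathrm{span}\{X_1,Y_1\}$ (so $m=1$) and $\mathfrak{g}_{-3}\ne\{0\}$; (ii) $\mathfrak{g}_{-1}=\mathrm{span}\{X_1,\dots,X_m,Y_1,\dots,Y_m\}$, $\mathfrak{g}_{-2}=\mathrm{span}\{U\}$ and $\mathfrak{g}_{-3}=\{0\}$; in this case $\mathfrak{g}$ is the Heisenberg algebra of dimension $2m+1$.
   Context: A real finite-dimensional Lie algebra $\mathfrak{g}$ (of dimension at least $3$) is stratified of step $\ell$ if $\mathfrak{g}=\mathfrak{g}_{-1}\oplus\cdots\oplus\mathfrak{g}_{-\ell}$, where $[\mathfrak{g}_{-j},\mathfrak{g}_{-1}]=\mathfrak{g}_{-j-1}$ for $1\le j\le\ell$, $\mathfrak{g}_{-\ell}\ne\{0\}$ and $\mathfrak{g}_{-\ell-1}=\{0\}$ (and $\mathfrak{g}_{-j}=\{0\}$ for $j>\ell$). A stratified group is a connected simply connected Lie group $G$ with stratified Lie algebra $\mathfrak{g}$. $G$ is tight if $\mathfrak{g}$ is totally nonabelian (that is, $\mathfrak{g}_{-1}$ meets the centre of $\mathfrak{g}$ only in $0$), $\mathfrak{g}$ is not a direct sum of two nontrivial ideals (its finest direct sum decomposition has only one factor), and $\dim\mathfrak{g}_{-2}=1$. Equivalently, $\mathfrak{g}_{-1}$ has a basis $X_1,\dots,X_m,Y_1,\dots,Y_m$ and $\mathfrak{g}_{-2}=\mathrm{span}\{U\}$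 with $[X_j,X_l]=[Y_j,Y_l]=0$ and $[X_j,Y_l]=\delta_{jl}U$ for all $j,l=1,\dots,m$; such a basis is fixed. A tight group is regarded as a CR stratified group with the almost complex structure $J:\mathfrak{g}_{-1}\to\mathfrak{g}_{-1}$ given by $JX_j=Y_j$, $JY_j=-X_j$. *)

theory Defs
  imports "HOL-Analysis.Analysis"
begin

section \<open>Lie groups\<close>

text \<open>These notions of differentiability are only used on open sets.\<close>

fun k_times_continuously_differentiable_on ::
  "nat \<Rightarrow> ('e::euclidean_space \<Rightarrow> 'f::real_normed_vector) \<Rightarrow> 'e set \<Rightarrow> bool" where
  "k_times_continuously_differentiable_on 0 f S \<longleftrightarrow> continuous_on S f"
| "k_times_continuously_differentiable_on (Suc k) f S \<longleftrightarrow>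
     f differentiable_on S \<and>
     (\<forall>v. k_times_continuously_differentiable_on k (\<lambda>x. frechet_derivative f (at x) v) S)"

definition smooth_on :: "'e::euclidean_space set \<Rightarrow> ('e \<Rightarrow> 'f::real_normed_vector) \<Rightarrow> bool" where
  "smooth_on S f \<longleftrightarrow> (\<forall>k. k_times_continuously_differentiable_on k f S)"

text \<open>A chart is a pair of its domain and its coordinate map. The values of the coordinate map
  outside of the domain are irrelevant. The atlas need not be maximal.\<close>

locale smooth_manifold =
  fixes \<A> :: "('g::{t2_space, second_countable_topology} set \<times> ('g \<Rightarrow> 'e::euclidean_space)) set"
  assumes chart: "(U, \<phi>) \<in> \<A> \<Longrightarrow>
      open U \<and> open (\<phi> ` U) \<and> (\<exists>\<psi>. homeomorphism U (\<phi> ` U) \<phi> \<psi>)"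
    and cover: "(\<Union>(U, \<phi>)\<in>\<A>. U) = UNIV"
    and compatible: "\<lbrakk>(U, \<phi>) \<in> \<A>; (V, \<psi>) \<in> \<A>\<rbrakk> \<Longrightarrow>
      smooth_on (\<phi> ` (U \<inter> V)) (\<psi> \<circ> inv_into U \<phi>)"

definition smooth_functions :: "('g set \<times> ('g \<Rightarrow> 'e::euclidean_space)) set \<Rightarrow> ('g \<Rightarrow> real) set" where
  "smooth_functions \<A> = {f. \<forall>(U, \<phi>)\<in>\<A>. smooth_on (\<phi> ` U) (f \<circ> inv_into U \<phi>)}"

text \<open>Continuity of the group operations guarantees that the sets on which smoothness is
  demanded below are open.\<close>

locale lie_group = smooth_manifold \<A> + group gmult gunit ginv
  for \<A> :: "('g::{t2_space, second_countable_topology} set \<times> ('g \<Rightarrow> 'e::euclidean_space)) set"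
    and gmult :: "'g \<Rightarrow> 'g \<Rightarrow> 'g" and gunit :: 'g and ginv :: "'g \<Rightarrow> 'g" +
  assumes continuous_mult: "continuous_on UNIV (\<lambda>(a, b). gmult a b)"
    and continuous_ginv: "continuous_on UNIV ginv"
    and smooth_mult: "\<lbrakk>(U, \<phi>) \<in> \<A>; (V, \<psi>) \<in> \<A>; (W, \<theta>) \<in> \<A>\<rbrakk> \<Longrightarrow>
      smooth_on {(\<phi> a, \<psi> b) |a b. a \<in> U \<and> b \<in> V \<and> gmult a b \<in> W}
        (\<lambda>(s, t). \<theta> (gmult (inv_into U \<phi> s) (inv_into V \<psi> t)))"
    and smooth_ginv: "\<lbrakk>(U, \<phi>) \<in> \<A>; (W, \<theta>) \<in> \<A>\<rbrakk> \<Longrightarrow>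
      smooth_on {\<phi> a |a. a \<in> U \<and> ginv a \<in> W} (\<lambda>s. \<theta> (ginv (inv_into U \<phi> s)))"

text \<open>Vector fields are regarded as derivations of the algebra of smooth functions.\<close>

definition left_invariant_vector_field ::
  "('g set \<times> ('g \<Rightarrow> 'e::euclidean_space)) set \<Rightarrow> ('g \<Rightarrow> 'g \<Rightarrow> 'g) \<Rightarrow>
   (('g \<Rightarrow> real) \<Rightarrow> ('g \<Rightarrow> real)) \<Rightarrow> bool" where
  "left_invariant_vector_field \<A> gmult D \<longleftrightarrow>
     (\<forall>f\<in>smooth_functions \<A>. D f \<in> smooth_functions \<A>) \<and>
     (\<forall>f\<in>smooth_functions \<A>. \<forall>h\<in>smooth_functions \<A>. \<forall>a b.
        D (\<lambda>p. a * f p + b * h p) = (\<lambda>p. a * D f p + b * D h p)) \<and>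
     (\<forall>f\<in>smooth_functions \<A>. \<forall>h\<in>smooth_functions \<A>.
        D (\<lambda>p. f p * h p) = (\<lambda>p. D f p * h p + f p * D h p)) \<and>
     (\<forall>f\<in>smooth_functions \<A>. \<forall>q. D (\<lambda>p. f (gmult q p)) = (\<lambda>p. D f (gmult q p)))"

text \<open>The vector space \<open>'a\<close> with the bracket \<open>br\<close> is (isomorphic to) the Lie algebra of the Lie
  group: \<open>\<Phi>\<close> is an isomorphism onto the left invariant vector fields with their commutator.
  Derivations are identified if they agree on all smooth functions.\<close>

definition is_lie_algebra_of ::
  "('a::real_vector \<Rightarrow> 'a \<Rightarrow> 'a) \<Rightarrow> ('g set \<times> ('g \<Rightarrow> 'e::euclidean_space)) set \<Rightarrow>
   ('g \<Rightarrow> 'g \<Rightarrow> 'g) \<Rightarrow> bool" where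
  "is_lie_algebra_of br \<A> gmult \<longleftrightarrow>
     (\<exists>\<Phi> :: 'a \<Rightarrow> ('g \<Rightarrow> real) \<Rightarrow> ('g \<Rightarrow> real).
        (\<forall>x. left_invariant_vector_field \<A> gmult (\<Phi> x)) \<and>
        (\<forall>x y a b. \<forall>f\<in>smooth_functions \<A>.
           \<Phi> (a *\<^sub>R x + b *\<^sub>R y) f = (\<lambda>p. a * \<Phi> x f p + b * \<Phi> y f p)) \<and>
        (\<forall>x y. \<forall>f\<in>smooth_functions \<A>.
           \<Phi> (br x y) f = (\<lambda>p. \<Phi> x (\<Phi> y f) p - \<Phi> y (\<Phi> x f) p)) \<and>
        (\<forall>D. left_invariant_vector_field \<A> gmult D \<longrightarrow>
           (\<exists>!x. \<forall>f\<in>smooth_functions \<A>. D f = \<Phi> x f)))"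

section \<open>Lie algebras\<close>

locale lie_algebra =
  fixes br :: "'a::real_vector \<Rightarrow> 'a \<Rightarrow> 'a"
  assumes bilinear: "bilinear br"
    and alternating: "br x x = 0"
    and jacobi: "br x (br y z) + br y (br z x) + br z (br x y) = 0"

definition lie_centre :: "('a::real_vector \<Rightarrow> 'a \<Rightarrow> 'a) \<Rightarrow> 'a set" where
  "lie_centre br = {z. \<forall>x. br z x = 0}"

definition lie_ideal :: "('a::real_vector \<Rightarrow> 'a \<Rightarrow> 'a) \<Rightarrow> 'a set \<Rightarrow> bool" where
  "lie_ideal br I \<longleftrightarrow> subspace I \<and> (\<forall>x. \<forall>y\<in>I. br x y \<in> I)"

text \<open>A stratification of step \<open>l\<close>. The stratum \<open>V j\<close> is \<open>\<gg>\<^sub>-\<^sub>j\<close> for \<open>j \<ge> 1\<close>; the set \<open>V 0\<close> has no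
  meaning.\<close>

locale stratified_lie_algebra = lie_algebra br
  for br :: "'a::real_vector \<Rightarrow> 'a \<Rightarrow> 'a" +
  fixes V :: "nat \<Rightarrow> 'a set" and l :: nat
  assumes finite_dimensional: "\<exists>B::'a set. finite B \<and> span B = UNIV"
    and dim_ge_3: "dim (UNIV :: 'a set) \<ge> 3"
    and subspace_stratum: "1 \<le> j \<Longrightarrow> subspace (V j)"
    and direct_sum: "\<exists>!v. v \<in> (\<Pi>\<^sub>E j\<in>{1..l}. V j) \<and> x = (\<Sum>j=1..l. v j)"
    and stratification: "j \<in> {1..l} \<Longrightarrow> span {br x y |x y. x \<in> V j \<and> y \<in> V 1} = V (Suc j)"
    and step_ge_1: "1 \<le> l"
    and last_stratum: "V l \<noteq> {0}"
    and trivial_strata: "l < j \<Longrightarrow> V j = {0}"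

definition totally_nonabelian :: "('a::real_vector \<Rightarrow> 'a \<Rightarrow> 'a) \<Rightarrow> (nat \<Rightarrow> 'a set) \<Rightarrow> bool" where
  "totally_nonabelian br V \<longleftrightarrow> V 1 \<inter> lie_centre br = {0}"

definition indecomposable :: "('a::real_vector \<Rightarrow> 'a \<Rightarrow> 'a) \<Rightarrow> bool" where
  "indecomposable br \<longleftrightarrow>
     \<not> (\<exists>I K. lie_ideal br I \<and> lie_ideal br K \<and> I \<noteq> {0} \<and> K \<noteq> {0} \<and>
            I \<inter> K = {0} \<and> {x + y |x y. x \<in> I \<and> y \<in> K} = UNIV)"

definition heisenberg_algebra :: "nat \<Rightarrow> ('a::real_vector \<Rightarrow> 'a \<Rightarrow> 'a) \<Rightarrow> bool" where
  "heisenberg_algebra m br \<longleftrightarrow> lie_algebra br \<and> dim (UNIV :: 'a set) = 2 * m + 1 \<and>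
     (\<exists>P Q Z. inj_on P {1..m} \<and> inj_on Q {1..m} \<and> P ` {1..m} \<inter> Q ` {1..m} = {} \<and>
        Z \<notin> P ` {1..m} \<union> Q ` {1..m} \<and>
        independent (insert Z (P ` {1..m} \<union> Q ` {1..m})) \<and>
        span (insert Z (P ` {1..m} \<union> Q ` {1..m})) = UNIV \<and>
        (\<forall>i\<in>{1..m}. \<forall>j\<in>{1..m}. br (P i) (P j) = 0 \<and> br (Q i) (Q j) = 0 \<and>
           br (P i) (Q j) = (if i = j then Z else 0)) \<and>
        (\<forall>i\<in>{1..m}. br (P i) Z = 0 \<and> br (Q i) Z = 0))"

section \<open>Tight CR stratified groups\<close>

locale stratified_group = lie_group \<A> gmult gunit ginv + stratified_lie_algebra br V l
  for \<A> :: "('g::{t2_space, second_countable_topology} set \<times> ('g \<Rightarrow> 'e::euclidean_space)) set"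
    and gmult :: "'g \<Rightarrow> 'g \<Rightarrow> 'g" and gunit :: 'g and ginv :: "'g \<Rightarrow> 'g"
    and br :: "'a::real_vector \<Rightarrow> 'a \<Rightarrow> 'a" and V :: "nat \<Rightarrow> 'a set" and l :: nat +
  assumes connected_group: "connected (UNIV :: 'g set)"
    and simply_connected_group: "simply_connected (UNIV :: 'g set)"
    and lie_algebra_of_group: "is_lie_algebra_of br \<A> gmult"

locale tight_group = stratified_group \<A> gmult gunit ginv br V l
  for \<A> :: "('g::{t2_space, second_countable_topology} set \<times> ('g \<Rightarrow> 'e::euclidean_space)) set"
    and gmult :: "'g \<Rightarrow> 'g \<Rightarrow> 'g" and gunit :: 'g and ginv :: "'g \<Rightarrow> 'g"
    and br :: "'a::real_vector \<Rightarrow> 'a \<Rightarrow> 'a" and V :: "nat \<Rightarrow> 'a set" and l :: nat +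
  assumes totally_nonabelian: "totally_nonabelian br V"
    and indecomposable: "indecomposable br"
    and dim_second_stratum: "dim (V 2) = 1"

text \<open>A choice of basis in a tight group, which exists by the theory of symplectic forms.\<close>

definition tight_basis ::
  "('a::real_vector \<Rightarrow> 'a \<Rightarrow> 'a) \<Rightarrow> (nat \<Rightarrow> 'a set) \<Rightarrow> nat \<Rightarrow>
   (nat \<Rightarrow> 'a) \<Rightarrow> (nat \<Rightarrow> 'a) \<Rightarrow> 'a \<Rightarrow> bool" where
  "tight_basis br V m X Y U \<longleftrightarrow>
     inj_on X {1..m} \<and> inj_on Y {1..m} \<and> X ` {1..m} \<inter> Y ` {1..m} = {} \<and>
     independent (X ` {1..m} \<union> Y ` {1..m}) \<and>
     span (X ` {1..m} \<union> Y ` {1..m}) = V 1 \<and>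
     span {U} = V 2 \<and>
     (\<forall>i\<in>{1..m}. \<forall>j\<in>{1..m}. br (X i) (X j) = 0 \<and> br (Y i) (Y j) = 0 \<and>
        br (X i) (Y j) = (if i = j then U else 0))"

definition almost_complex_structure_on :: "'a::real_vector set \<Rightarrow> ('a \<Rightarrow> 'a) \<Rightarrow> bool" where
  "almost_complex_structure_on W J \<longleftrightarrow>
     J ` W \<subseteq> W \<and>
     (\<forall>x\<in>W. \<forall>y\<in>W. \<forall>a b. J (a *\<^sub>R x + b *\<^sub>R y) = a *\<^sub>R J x + b *\<^sub>R J y) \<and>
     (\<forall>x\<in>W. J (J x) = - x)"

locale tight_CR_stratified_group = tight_group \<A> gmult gunit ginv br V l
  for \<A> :: "('g::{t2_space, second_countable_topology} set \<times> ('g \<Rightarrow> 'e::euclidean_space)) set"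
    and gmult :: "'g \<Rightarrow> 'g \<Rightarrow> 'g" and gunit :: 'g and ginv :: "'g \<Rightarrow> 'g"
    and br :: "'a::real_vector \<Rightarrow> 'a \<Rightarrow> 'a" and V :: "nat \<Rightarrow> 'a set" and l :: nat +
  fixes m :: nat and X Y :: "nat \<Rightarrow> 'a" and U :: 'a and J :: "'a \<Rightarrow> 'a"
  assumes tight_basis: "tight_basis br V m X Y U"
    and almost_complex: "almost_complex_structure_on (V 1) J"
    and J_X: "j \<in> {1..m} \<Longrightarrow> J (X j) = Y j"
    and J_Y: "j \<in> {1..m} \<Longrightarrow> J (Y j) = - X j"

end

theory Submission
  imports Defs
begin

text \<open>If \<open>m \<ge> 2\<close>, every basis vector \<open>X\<^sub>i\<close> or \<open>Y\<^sub>i\<close> commutes with both \<open>X\<^sub>j\<close> and \<open>Y\<^sub>j\<close> for some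
  \<open>j \<noteq> i\<close>, hence by the Jacobi identity with \<open>U = [X\<^sub>j, Y\<^sub>j]\<close>; therefore \<open>\<gg>\<^sub>-\<^sub>3 = [\<gg>\<^sub>-\<^sub>2, \<gg>\<^sub>-\<^sub>1] = 0\<close>.
  Once \<open>\<gg>\<^sub>-\<^sub>3 = 0\<close>, the step is \<open>2\<close> and \<open>\<gg> = \<gg>\<^sub>-\<^sub>1 \<oplus> \<gg>\<^sub>-\<^sub>2\<close> has the Heisenberg relations.\<close>

context lie_algebra
begin

lemma br_zero [simp]: "br 0 y = 0" "br x 0 = 0"
  using bilinear by (simp_all add: bilinear_lzero bilinear_rzero)

lemma anticommute: "br x y = - br y x"
proof -
  have "br (x + y) (x + y) = br x y + br y x"
    using bilinear by (simp add: bilinear_ladd bilinear_radd alternating[of x] alternating[of y])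
  then show ?thesis
    by (simp add: alternating eq_neg_iff_add_eq_0)
qed

text \<open>By the Jacobi identity \<open>br x\<close> is a derivation, so its kernel is closed
  under the bracket.\<close>

lemma br_br_eq_0:
  assumes "br x y = 0" "br x z = 0"
  shows "br x (br y z) = 0"
proof -
  have "br z x = 0"
    using assms(2) anticommute[of z x] by simp
  then show ?thesis
    using jacobi[of x y z] assms(1) by simp
qed

text \<open>Reduces the vanishing of the bracket on \<open>V 2\<close> and \<open>V 1\<close> to
  brackets of \<open>U\<close> with basis vectors.\<close>

lemma br_span_eq_0:
  assumes "\<And>b. b \<in> B \<Longrightarrow> br u b = 0" and "x \<in> span {u}" "y \<in> span B"
  shows "br x y = 0"
proof -
  have "br u y = 0"
    using linear_eq_0_on_span[of "br u" B y] bilinear assms(1,3)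
    by (simp add: bilinear_def)
  then show ?thesis
    using \<open>x \<in> span {u}\<close> bilinear by (auto simp: span_singleton bilinear_lmul)
qed

end

context stratified_lie_algebra
begin

lemma br_in_next_stratum:
  assumes "j \<in> {1..l}" "x \<in> V j" "y \<in> V 1"
  shows "br x y \<in> V (Suc j)"
  using stratification[OF assms(1)] assms(2,3) by (blast intro: span_base)

lemma next_stratum_eq_0:
  assumes "j \<in> {1..l}" "\<And>x y. x \<in> V j \<Longrightarrow> y \<in> V 1 \<Longrightarrow> br x y = 0"
  shows "V (Suc j) = {0}"
proof -
  have "{br x y |x y. x \<in> V j \<and> y \<in> V 1} \<subseteq> {0}"
    using assms(2) by auto
  from span_mono[OF this] have "V (Suc j) \<subseteq> {0}"
    using stratification[OF assms(1)] by simp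
  then show ?thesis
    using subspace_0[OF subspace_stratum[of "Suc j"]] by auto
qed

text \<open>Up to index \<open>l\<close>, each stratum generates the next by bracketing with
  \<open>V 1\<close>, so vanishing propagates; beyond \<open>l\<close> the strata are zero by
  \<open>trivial_strata\<close>.\<close>

lemma later_strata_eq_0:
  assumes "V j = {0}" "1 \<le> j" "j \<le> k"
  shows "V k = {0}"
  using assms(3)
proof (induction k rule: dec_induct)
  case base
  show ?case by (fact assms(1))
next
  case (step k)
  show ?case
  proof (cases "k \<le> l")
    case True
    then show ?thesis
      using step assms(2) by (intro next_stratum_eq_0) auto
  next
    case False
    then show ?thesis by (intro trivial_strata) simp
  qed
qed

text \<open>If \<open>3 \<le> l\<close>, the vanishing of \<open>V 3\<close> would propagate to the
  last stratum \<open>V l\<close>.\<close>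

lemma step_eq_2:
  assumes "V 2 \<noteq> {0}" "V 3 = {0}"
  shows "l = 2"
proof -
  have "\<not> 3 \<le> l"
    using later_strata_eq_0[OF assms(2)] last_stratum by auto
  moreover have "2 \<le> l"
    using trivial_strata[of 2] assms(1) by linarith
  ultimately show ?thesis by simp
qed

text \<open>Turns the unique existence of extensional families in \<open>direct_sum\<close> into the
  usual internal direct sum of two subspaces.\<close>

lemma step_2_decomposition:
  assumes "l = 2"
  shows "V 1 \<inter> V 2 = {0}" and "\<exists>y\<in>V 1. \<exists>z\<in>V 2. x = y + z"
proof -
  have sub: "subspace (V 1)" "subspace (V 2)"
    by (simp_all add: subspace_stratum)
  \<comment> \<open>The simplifier rewrites \<open>1\<close> to \<open>Suc 0\<close>, hence this
    form.\<close>
  have ivl: "{Suc 0..l} = {Suc 0, 2}"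
    using assms by auto
  show "V 1 \<inter> V 2 = {0}"
  proof (intro equalityI subsetI)
    fix u assume u: "u \<in> V 1 \<inter> V 2"
    \<comment> \<open>Two decompositions of \<open>u\<close>, one with \<open>u\<close> in
      \<open>V 1\<close>, the other with \<open>u\<close> in \<open>V 2\<close>; uniqueness
      identifies them, so \<open>u = 0\<close>. The restriction makes them extensional.\<close>
    define f where "f = restrict (\<lambda>j. if j = 1 then u else 0) {1..l}"
    define g where "g = restrict (\<lambda>j. if j = 1 then 0 else u) {1..l}"
    have "f \<in> (\<Pi>\<^sub>E j\<in>{1..l}. V j)" "g \<in> (\<Pi>\<^sub>E j\<in>{1..l}. V j)"
      using u sub by (auto simp: f_def g_def ivl subspace_0)
    moreover have "u = (\<Sum>j=1..l. f j)" "u = (\<Sum>j=1..l. g j)"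
      by (simp_all add: f_def g_def ivl)
    ultimately have "f = g"
      using direct_sum[of u] by blast
    then have "f 1 = g 1" by simp
    then show "u \<in> {0}"
      by (simp add: f_def g_def ivl)
  qed (use sub in \<open>auto simp: subspace_0\<close>)
  obtain v where v: "v \<in> (\<Pi>\<^sub>E j\<in>{1..l}. V j)" "x = (\<Sum>j=1..l. v j)"
    using direct_sum[of x] by blast
  then have "v 1 \<in> V 1" "v 2 \<in> V 2" "x = v 1 + v 2"
    by (auto simp: ivl)
  then show "\<exists>y\<in>V 1. \<exists>z\<in>V 2. x = y + z" by blast
qed

lemma tight_basis_third_stratum:
  assumes basis: "tight_basis br V m X Y U" and "2 \<le> m" "2 \<le> l"
  shows "V 3 = {0}"
proof -
  let ?B = "X ` {1..m} \<union> Y ` {1..m}"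
  have rel: "br (X i) (X j) = 0" "br (Y i) (Y j) = 0" "br (X i) (Y j) = (if i = j then U else 0)"
    if "i \<in> {1..m}" "j \<in> {1..m}" for i j
    using basis that unfolding tight_basis_def by blast+
  have "br U b = 0" if "b \<in> ?B" for b
  proof -
    obtain i where i: "i \<in> {1..m}" "b = X i \<or> b = Y i"
      using \<open>b \<in> ?B\<close> by blast
    \<comment> \<open>Some index other than \<open>i\<close>, available since
      \<open>2 \<le> m\<close>; then \<open>b\<close> commutes with \<open>X j\<close> and
      \<open>Y j\<close>, hence with their bracket \<open>U\<close>.\<close>
    define j where "j = (if i = 1 then 2 else 1 :: nat)"
    have j: "j \<in> {1..m}" "i \<noteq> j"
      using \<open>2 \<le> m\<close> by (auto simp: j_def)
    have "br b (X j) = 0" "br b (Y j) = 0"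
      using i j rel anticommute[of "Y i" "X j"] by auto
    then have "br b (br (X j) (Y j)) = 0"
      by (rule br_br_eq_0)
    then show "br U b = 0"
      using rel(3)[OF j(1) j(1)] anticommute[of U b] by simp
  qed
  moreover have "V 1 = span ?B" "V 2 = span {U}"
    using basis by (simp_all add: tight_basis_def)
  ultimately have "br x y = 0" if "x \<in> V 2" "y \<in> V 1" for x y
    using that br_span_eq_0 by blast
  then show ?thesis
    using next_stratum_eq_0[of 2] \<open>2 \<le> l\<close> by simp
qed

lemma tight_basis_heisenberg:
  assumes basis: "tight_basis br V m X Y U" and "V 2 \<noteq> {0}" "V 3 = {0}"
  shows "heisenberg_algebra m br"
proof -
  let ?B = "X ` {1..m} \<union> Y ` {1..m}"
  have inj: "inj_on X {1..m}" "inj_on Y {1..m}" and disj: "X ` {1..m} \<inter> Y ` {1..m} = {}"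
    and ind: "independent ?B" and V1: "span ?B = V 1" and V2: "span {U} = V 2"
    and rel: "\<forall>i\<in>{1..m}. \<forall>j\<in>{1..m}. br (X i) (X j) = 0 \<and> br (Y i) (Y j) = 0 \<and>
        br (X i) (Y j) = (if i = j then U else 0)"
    using basis unfolding tight_basis_def by blast+
  have l: "l = 2"
    using assms by (intro step_eq_2)
  have "U \<noteq> 0"
    using assms(2) by (auto simp flip: V2)
  have U2: "U \<in> V 2"
    using V2 span_base[of U "{U}"] by simp
  have U1: "U \<notin> span ?B"
    \<comment> \<open>\<open>U\<close> is a nonzero vector of \<open>V 2\<close>, which meets
      \<open>V 1\<close> only in zero.\<close>
    using step_2_decomposition(1)[OF l] V1 U2 \<open>U \<noteq> 0\<close> by blast
  then have UB: "U \<notin> ?B"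
    using span_base[of U ?B] by argo
  have ind': "independent (insert U ?B)"
    using ind U1 UB by (simp add: independent_insert)
  have sp: "span (insert U ?B) = UNIV"
  proof (intro equalityI subsetI)
    fix x
    obtain y z where "y \<in> V 1" "z \<in> V 2" "x = y + z"
      using step_2_decomposition(2)[OF l] by blast
    moreover have "V 1 \<subseteq> span (insert U ?B)" "V 2 \<subseteq> span (insert U ?B)"
      unfolding V1[symmetric] V2[symmetric] by (intro span_mono; blast)+
    ultimately show "x \<in> span (insert U ?B)"
      by (auto intro: span_add)
  qed simp
  have "card (insert U ?B) = 2 * m + 1"
    using UB disj inj by (simp add: card_Un_disjoint card_image)
  then have "dim (UNIV :: 'a set) = 2 * m + 1"
    using dim_eq_card[of "insert U ?B" UNIV] sp ind' by simp
  moreover have "br b U = 0" if "b \<in> ?B" for b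
  proof -
    have "b \<in> V 1"
      using span_base[OF that] unfolding V1 .
    \<comment> \<open>\<open>U\<close> is central for reasons of degree: its brackets with
      \<open>V 1\<close> land in the zero stratum \<open>V 3\<close>.\<close>
    then have "br U b \<in> V 3"
      using br_in_next_stratum[of 2 U b] U2 l by simp
    then show "br b U = 0"
      using \<open>V 3 = {0}\<close> anticommute[of b U] by simp
  qed
  then have "\<forall>i\<in>{1..m}. br (X i) U = 0 \<and> br (Y i) U = 0"
    by blast
  moreover have "lie_algebra br"
    by (fact lie_algebra_axioms)
  ultimately show ?thesis
    unfolding heisenberg_algebra_def using inj disj UB ind' sp rel by blast
qed

end

theorem corollary3p2:
  fixes \<A> :: "('g::{t2_space, second_countable_topology} set \<times> ('g \<Rightarrow> 'e::euclidean_space)) set"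
    and gmult :: "'g \<Rightarrow> 'g \<Rightarrow> 'g" and gunit :: 'g and ginv :: "'g \<Rightarrow> 'g"
    and br :: "'a::real_vector \<Rightarrow> 'a \<Rightarrow> 'a" and V :: "nat \<Rightarrow> 'a set" and l m :: nat
    and X Y :: "nat \<Rightarrow> 'a" and U :: 'a and J :: "'a \<Rightarrow> 'a"
  assumes "tight_CR_stratified_group \<A> gmult gunit ginv br V l m X Y U J"
    and "dim (V 1) = 2 * m"
  shows
    "let case_i = (V 1 = span {X 1, Y 1} \<and> V 3 \<noteq> {0});
         case_ii = (V 1 = span (X ` {1..m} \<union> Y ` {1..m}) \<and> V 2 = span {U} \<and> V 3 = {0})
     in (case_i \<and> \<not> case_ii \<or> \<not> case_i \<and> case_ii) \<and>
        (case_i \<longrightarrow> m = 1) \<and>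
        (case_ii \<longrightarrow> heisenberg_algebra m br)"
proof -
  interpret tight_CR_stratified_group \<A> gmult gunit ginv br V l m X Y U J
    by (fact assms(1))
  have V1: "V 1 = span (X ` {1..m} \<union> Y ` {1..m})" and V2: "V 2 = span {U}"
    using tight_basis by (simp_all add: tight_basis_def)
  have V2_nz: "V 2 \<noteq> {0}"
  proof
    assume "V 2 = {0}"
    then have "dim (V 2) = 0"
      using dim_eq_card[of "{}" "V 2"] by (simp add: independent_empty)
    then show False
      using dim_second_stratum by linarith
  qed
  then have "2 \<le> l"
    using trivial_strata[of 2] by linarith
  \<comment> \<open>With no basis vectors \<open>V 1\<close> would vanish, and with it
    \<open>V 2\<close>.\<close>
  have "m \<noteq> 0"
  proof
    assume "m = 0"
    then have "V 1 = {0}"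
      using V1 by simp
    then show False
      using later_strata_eq_0[of 1 2] V2_nz by simp
  qed
  have m1: "m = 1" if "V 3 \<noteq> {0}"
    using that tight_basis_third_stratum[OF tight_basis _ \<open>2 \<le> l\<close>] \<open>m \<noteq> 0\<close> by linarith
  have "V 1 = span {X 1, Y 1}" if "V 3 \<noteq> {0}"
    using V1 m1[OF that] by (simp add: insert_commute)
  moreover have "heisenberg_algebra m br" if "V 3 = {0}"
    using tight_basis_heisenberg[OF tight_basis V2_nz that] .
  \<comment> \<open>The spans in \<open>case_ii\<close> come from \<open>tight_basis\<close>, so
    \<open>case_i\<close> amounts to \<open>V 3 \<noteq> {0}\<close> and \<open>case_ii\<close> to
    \<open>V 3 = {0}\<close>; hence exactly one holds.\<close>
  ultimately show ?thesis
    unfolding Let_def using V1 V2 m1 by blast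
qed

end
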